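(* Let $n$ be an integer with $n\ge 6$ and $n\equiv 2 \pmod 4$. Then there exists a $2$-subset-regular self-complementary $3$-hypergraph on $n$ vertices.
   Context: For a set $V$ and a positive integer $k$, write $V^{(k)}=\{e\subseteq V : |e|=k\}$. A $k$-hypergraph (short for $k$-uniform hypergraph) of order $n$ (on $n$ vertices) is an ordered pair $\Gamma=(V,E)$, where $V=V(\Gamma)$ is a set of size $n$ and $E=E(\Gamma)$ is a subset of $V^{(k)}$. The complement of a $k$-hypergraph $\Gamma$ is the $k$-hypergraph $\Gamma^C$ with $V(\Gamma^C)=V(\Gamma)$ and $E(\Gamma^C)=V(\Gamma)^{(k)}\setminus E(\Gamma)$. A $k$-hypergraph $\Gamma=(V,E)$ is self-complementary if it is isomorphic to $\Gamma^C$; equivalently, if there exists a permutation $\tau$ of $V$ such that for all $e\in V^{(k)}$ one has $e\in E$ if and only if $e^\tau\notin E$, where $e^\tau$ denotes the image of the set $e$ under $\tau$. A $k$-hypergraph $\Gamma$ is $t$-subset-regular if there exists an integer $\lambda$ such that each $t$-element subset of $V(\Gamma)$ is a subset of exactly $\lambda$ elements of $E(\Gamma)$. *)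

theory Defs
  imports "HOL-Library.Ramsey" "HOL-Number_Theory.Cong"
begin

type_synonym 'a hypergraph = "'a set \<times> 'a set set"

abbreviation verts :: "'a hypergraph \<Rightarrow> 'a set" where
  "verts \<equiv> fst"

abbreviation edges :: "'a hypergraph \<Rightarrow> 'a set set" where
  "edges \<equiv> snd"

text \<open>The set of k-element subsets of V is \<^term>\<open>nsets V k\<close>. The vertex set is required to be
  finite, so that its cardinality is the order of the hypergraph.\<close>

definition k_hypergraph :: "nat \<Rightarrow> 'a hypergraph \<Rightarrow> bool" where
  "k_hypergraph k \<Gamma> \<longleftrightarrow> k > 0 \<and> finite (verts \<Gamma>) \<and> edges \<Gamma> \<subseteq> nsets (verts \<Gamma>) k"

text \<open>The uniformity k is a parameter, since it cannot be recovered from an empty edge set.\<close>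

definition complement :: "nat \<Rightarrow> 'a hypergraph \<Rightarrow> 'a hypergraph" where
  "complement k \<Gamma> = (verts \<Gamma>, nsets (verts \<Gamma>) k - edges \<Gamma>)"

definition isomorphic :: "'a hypergraph \<Rightarrow> 'b hypergraph \<Rightarrow> bool" where
  "isomorphic \<Gamma> \<Delta> \<longleftrightarrow>
    (\<exists>f. bij_betw f (verts \<Gamma>) (verts \<Delta>) \<and> (\<lambda>e. f ` e) ` edges \<Gamma> = edges \<Delta>)"

definition self_complementary :: "nat \<Rightarrow> 'a hypergraph \<Rightarrow> bool" where
  "self_complementary k \<Gamma> \<longleftrightarrow> isomorphic \<Gamma> (complement k \<Gamma>)"

definition subset_regular :: "nat \<Rightarrow> 'a hypergraph \<Rightarrow> bool" where
  "subset_regular t \<Gamma> \<longleftrightarrow>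
    (\<exists>l::nat. \<forall>T \<in> nsets (verts \<Gamma>) t. card {e \<in> edges \<Gamma>. T \<subseteq> e} = l)"

end

theory Submission
  imports Defs
begin

text \<open>Write \<open>n = 4k + 2\<close> and let \<open>\<tau>\<close> be an involution without fixed points that flips a sign
  attached to each vertex. Every vertex \<open>x\<close> of a triple \<open>e\<close> casts a vote, namely its sign
  multiplied by a \<open>\<tau>\<close>-invariant factor, so that \<open>\<tau>\<close> reverses all votes; \<open>e\<close> is an edge if the
  majority of its vertices votes for it. Hence \<open>\<tau>\<close> maps edges to non-edges. The factor is
  the parity of the size of the intersection of \<open>e\<close> with a set \<open>B x\<close>, a union of \<open>k\<close> of the
  \<open>2k\<close> pairs \<open>{z, \<tau> z}\<close> other than \<open>{x, \<tau> x}\<close>: the votes of \<open>x\<close> and \<open>y\<close> in \<open>{x, y, z}\<close> do not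
  change when \<open>z\<close> is replaced by \<open>\<tau> z\<close>, while the vote of \<open>z\<close> is reversed, so the number of
  edges containing \<open>x\<close> and \<open>y\<close> is determined by how often \<open>x\<close> and \<open>y\<close> vote positively, and this
  is balanced because \<open>B x\<close> takes half of the pairs.\<close>

locale signed_vote =
  fixes V :: "'a set" and \<tau> :: "'a \<Rightarrow> 'a" and s :: "'a \<Rightarrow> bool" and B :: "'a \<Rightarrow> 'a set"
    and k :: nat
  assumes finite_V: "finite V"
    and card_V: "card V = 4 * k + 2"
    and tau_closed: "x \<in> V \<Longrightarrow> \<tau> x \<in> V"
    and tau_tau: "x \<in> V \<Longrightarrow> \<tau> (\<tau> x) = x"
    and sign_tau: "x \<in> V \<Longrightarrow> s (\<tau> x) \<longleftrightarrow> \<not> s x"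
    and B_subset: "x \<in> V \<Longrightarrow> B x \<subseteq> V"
    and B_tau: "x \<in> V \<Longrightarrow> B (\<tau> x) = B x"
    and tau_B: "x \<in> V \<Longrightarrow> z \<in> B x \<Longrightarrow> \<tau> z \<in> B x"
    and not_in_B: "x \<in> V \<Longrightarrow> x \<notin> B x"
    and card_B: "x \<in> V \<Longrightarrow> card (B x) = 2 * k"
begin

text \<open>For a triple \<open>e\<close> containing \<open>x\<close>, \<open>x \<notin> B x\<close>
  leaves at most two elements in \<open>e \<inter> B x\<close>, so size one means odd size.\<close>

definition vote :: "'a set \<Rightarrow> 'a \<Rightarrow> bool" where
  "vote e x \<longleftrightarrow> (s x \<longleftrightarrow> card (e \<inter> B x) = 1)"

definition majority_edges :: "'a set set" where
  "majority_edges = {e \<in> nsets V 3. 2 \<le> card {x \<in> e. vote e x}}"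

section \<open>Reversal of votes and self-complementarity\<close>

lemma tau_neq: "x \<in> V \<Longrightarrow> \<tau> x \<noteq> x"
  using sign_tau by metis

lemma tau_closed_Diff:
  assumes "x \<in> V" "z \<in> V - {x, \<tau> x}"
  shows "\<tau> z \<in> V - {x, \<tau> x}"
proof -
  have "\<tau> z \<noteq> x" "\<tau> z \<noteq> \<tau> x" using assms tau_tau by (metis DiffE insertCI)+
  then show ?thesis using assms tau_closed by simp
qed

lemma tau_in_B_iff: "x \<in> V \<Longrightarrow> z \<in> V \<Longrightarrow> \<tau> z \<in> B x \<longleftrightarrow> z \<in> B x"
  using tau_B tau_tau by metis

lemma inj_on_tau: "inj_on \<tau> V"
  by (rule inj_on_inverseI) (rule tau_tau)

lemma tau_image_nsets: "e \<in> nsets V j \<Longrightarrow> \<tau> ` e \<in> nsets V j"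
  using inj_on_tau tau_closed
  by (auto simp: nsets_def card_image inj_on_subset)

text \<open>Since \<open>B x\<close> is \<tau>-invariant and shared by \<open>x\<close> and
  \<open>\<tau> x\<close>, applying \<tau> preserves the size of the intersection; only the sign
  changes.\<close>

lemma vote_tau:
  assumes "e \<subseteq> V" "x \<in> V"
  shows "vote (\<tau> ` e) (\<tau> x) \<longleftrightarrow> \<not> vote e x"
proof -
  have "\<tau> ` e \<inter> B (\<tau> x) = \<tau> ` (e \<inter> B x)"
    using assms tau_in_B_iff B_tau by auto
  moreover have "inj_on \<tau> (e \<inter> B x)"
    by (rule inj_on_subset[OF inj_on_tau]) (use assms in auto)
  ultimately have "card (\<tau> ` e \<inter> B (\<tau> x)) = card (e \<inter> B x)"
    by (simp add: card_image)
  then show ?thesis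
    using sign_tau[OF assms(2)] by (auto simp: vote_def)
qed

text \<open>With three voters there are no ties: exactly one of the two camps has at least two
  members, and \<tau> exchanges the camps.\<close>

lemma tau_image_edge_iff:
  assumes e: "e \<in> nsets V 3"
  shows "\<tau> ` e \<in> majority_edges \<longleftrightarrow> e \<notin> majority_edges"
proof -
  have sub: "e \<subseteq> V" and fin: "finite e" and card: "card e = 3"
    using e by (auto simp: nsets_def)
  have "{y \<in> \<tau> ` e. vote (\<tau> ` e) y} = \<tau> ` {x \<in> e. \<not> vote e x}"
    using vote_tau[OF sub] sub by auto
  moreover have "inj_on \<tau> {x \<in> e. \<not> vote e x}"
    by (rule inj_on_subset[OF inj_on_tau]) (use sub in auto)
  ultimately have "card {y \<in> \<tau> ` e. vote (\<tau> ` e) y} = card {x \<in> e. \<not> vote e x}"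
    by (simp add: card_image)
  moreover have "card {x \<in> e. vote e x} + card {x \<in> e. \<not> vote e x} = 3"
    unfolding card[symmetric] using fin
    by (subst card_Un_disjoint[symmetric]) (auto intro: arg_cong[where f = card])
  ultimately show ?thesis
    using e tau_image_nsets[OF e] by (auto simp: majority_edges_def)
qed

lemma self_complementary_majority: "self_complementary 3 (V, majority_edges)"
proof -
  have tau_image_involution: "\<tau> ` \<tau> ` e = e" if "e \<subseteq> V" for e
    using that tau_tau by (force simp: image_image)
  have "bij_betw \<tau> V V"
    by (rule bij_betw_byWitness[where f' = \<tau>]) (auto simp: tau_tau tau_closed)
  moreover have "(\<lambda>e. \<tau> ` e) ` majority_edges = nsets V 3 - majority_edges"
  proof (intro equalityI subsetI)
    fix e assume "e \<in> (\<lambda>e. \<tau> ` e) ` majority_edges"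
    then obtain d where d: "d \<in> majority_edges" "e = \<tau> ` d" by blast
    then have "d \<in> nsets V 3" by (simp add: majority_edges_def)
    then show "e \<in> nsets V 3 - majority_edges"
      using d tau_image_nsets tau_image_edge_iff by simp
  next
    fix e assume e: "e \<in> nsets V 3 - majority_edges"
    then have "\<tau> ` e \<in> majority_edges" using tau_image_edge_iff by simp
    moreover have "e = \<tau> ` \<tau> ` e"
      using e tau_image_involution by (simp add: nsets_def)
    ultimately show "e \<in> (\<lambda>e. \<tau> ` e) ` majority_edges" by blast
  qed
  ultimately show ?thesis
    unfolding self_complementary_def isomorphic_def complement_def by auto
qed

section \<open>Edges in terms of membership in the sets \<open>B x\<close>\<close>

lemma vote_triple:
  assumes "x \<in> V" "y \<noteq> z"
  shows "vote {x, y, z} x \<longleftrightarrow> (s x \<longleftrightarrow> (y \<in> B x) \<noteq> (z \<in> B x))"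
  using assms not_in_B[OF assms(1)] by (auto simp: vote_def Int_insert_left)

lemma triple_edge_iff:
  assumes "x \<in> V" "y \<in> V" "z \<in> V" "x \<noteq> y" "x \<noteq> z" "y \<noteq> z"
  defines "p \<equiv> s x \<longleftrightarrow> (y \<in> B x) \<noteq> (z \<in> B x)"
    and "q \<equiv> s y \<longleftrightarrow> (x \<in> B y) \<noteq> (z \<in> B y)"
    and "r \<equiv> s z \<longleftrightarrow> (x \<in> B z) \<noteq> (y \<in> B z)"
  shows "{x, y, z} \<in> majority_edges \<longleftrightarrow> p \<and> q \<or> p \<and> r \<or> q \<and> r"
proof -
  have p: "vote {x, y, z} x \<longleftrightarrow> p"
    using vote_triple[of x y z] assms by simp
  have q: "vote {x, y, z} y \<longleftrightarrow> q"
    using vote_triple[of y x z] assms by (simp add: insert_commute)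
  have r: "vote {x, y, z} z \<longleftrightarrow> r"
    using vote_triple[of z x y] assms by (simp add: insert_commute)
  have "{u \<in> {x, y, z}. vote {x, y, z} u} =
      (if p then {x} else {}) \<union> (if q then {y} else {}) \<union> (if r then {z} else {})"
    using p q r by auto
  moreover have "{x, y, z} \<in> nsets V 3"
    using assms by (simp add: nsets_def)
  ultimately show ?thesis
    using assms(4-6) by (simp add: majority_edges_def)
qed

text \<open>The votes of \<open>x\<close> and \<open>\<tau> x\<close> are opposite, so
  \<open>z\<close> decides. As \<open>B z\<close> contains both or neither of them, the parity
  factor of \<open>z\<close> is even and its vote is \<open>\<not> s z\<close>.\<close>

lemma pair_with_tau_edge_iff:
  assumes "x \<in> V" "z \<in> V" "z \<noteq> x" "z \<noteq> \<tau> x"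
  shows "{x, \<tau> x, z} \<in> majority_edges \<longleftrightarrow> \<not> s z"
  using assms triple_edge_iff[of x "\<tau> x" z] tau_neq[of x] tau_closed[of x]
    tau_in_B_iff[of x x] tau_in_B_iff[of z x] B_tau[of x] sign_tau[of x] not_in_B[of x]
  by auto

section \<open>Counting the edges through a pair of vertices\<close>

lemma sum_tau_double:
  fixes f :: "'a \<Rightarrow> nat"
  assumes "W \<subseteq> V" "\<And>z. z \<in> W \<Longrightarrow> \<tau> z \<in> W"
  shows "2 * (\<Sum>z\<in>W. f z) = (\<Sum>z\<in>W. f z + f (\<tau> z))"
proof -
  have "(\<Sum>z\<in>W. f (\<tau> z)) = (\<Sum>z\<in>W. f z)"
    by (rule sum.reindex_bij_witness[where i = \<tau> and j = \<tau>])
      (use assms tau_tau in \<open>auto simp: subset_iff\<close>)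
  then show ?thesis by (simp add: sum.distrib)
qed

text \<open>An edge through \<open>x\<close> and \<open>y\<close> is determined by its third vertex,
  so edges are counted by that vertex.\<close>

lemma card_edges_containing_pair:
  assumes "x \<in> V" "y \<in> V" "x \<noteq> y"
  shows "card {e \<in> majority_edges. {x, y} \<subseteq> e} =
    (\<Sum>z\<in>V - {x, y}. of_bool ({x, y, z} \<in> majority_edges))"
proof -
  let ?Z = "{z \<in> V - {x, y}. {x, y, z} \<in> majority_edges}"
  have "{e \<in> majority_edges. {x, y} \<subseteq> e} \<subseteq> (\<lambda>z. {x, y, z}) ` ?Z"
  proof
    fix e assume e: "e \<in> {e \<in> majority_edges. {x, y} \<subseteq> e}"
    then have sub: "e \<subseteq> V" "finite e" "card e = 3"
      by (auto simp: majority_edges_def nsets_def)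
    then have "card (e - {x, y}) = 1"
      using e assms(3) by (simp add: card_Diff_subset)
    then obtain z where z: "e - {x, y} = {z}" by (auto simp: card_1_singleton_iff)
    then have "e = {x, y, z}" using e by auto
    then show "e \<in> (\<lambda>z. {x, y, z}) ` ?Z" using e z sub by blast
  qed
  then have "{e \<in> majority_edges. {x, y} \<subseteq> e} = (\<lambda>z. {x, y, z}) ` ?Z" by auto
  moreover have "inj_on (\<lambda>z. {x, y, z}) ?Z" by (auto simp: inj_on_def)
  ultimately have "card {e \<in> majority_edges. {x, y} \<subseteq> e} = card ?Z"
    by (simp add: card_image)
  also have "?Z = (V - {x, y}) \<inter> {z. {x, y, z} \<in> majority_edges}" by auto
  finally show ?thesis using finite_V by (simp add: sum_of_bool_eq)
qed

text \<open>The set \<open>B x\<close> takes \<open>k\<close> of the \<open>2 * k\<close> pairs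
  other than that of \<open>x\<close>. Deleting the pair of \<open>y\<close> removes one pair from
  the side of \<open>B x\<close> that contains \<open>y\<close>, leaving \<open>2 * k\<close>
  vertices on the other side and \<open>2 * k - 2\<close> on this one. If \<open>s x\<close> holds,
  the positive votes come from the larger side, otherwise from the smaller; the added term makes up
  the difference.\<close>

lemma card_positive_votes:
  assumes x: "x \<in> V" and y: "y \<in> V" "y \<noteq> x" "y \<noteq> \<tau> x"
  shows "(\<Sum>z\<in>V - {x, \<tau> x, y, \<tau> y}. of_bool (s x \<longleftrightarrow> (y \<in> B x) \<noteq> (z \<in> B x)))
    + 2 * of_bool (\<not> s x) = 2 * k"
proof -
  let ?W = "V - {x, \<tau> x, y, \<tau> y}"
  have card4: "card {x, \<tau> x, y, \<tau> y} = 4"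
  proof -
    have "x \<noteq> \<tau> y" "\<tau> x \<noteq> \<tau> y" "\<tau> x \<noteq> x" "\<tau> y \<noteq> y"
      using assms tau_tau tau_neq by metis+
    then show ?thesis using y by simp
  qed
  have sub4: "{x, \<tau> x, y, \<tau> y} \<subseteq> V" using x y tau_closed by auto
  have fin: "finite ?W" "finite (B x)"
    using finite_V B_subset[OF x] finite_subset by auto
  have card_W: "card ?W = 4 * k - 2"
    using card4 sub4 card_V by (simp add: card_Diff_subset)
  have \<tau>x: "\<tau> x \<notin> B x" using tau_in_B_iff[of x x] x not_in_B by simp
  have sum: "(\<Sum>z\<in>?W. of_bool (s x \<longleftrightarrow> (y \<in> B x) \<noteq> (z \<in> B x)))
      = card {z \<in> ?W. s x \<longleftrightarrow> (y \<in> B x) \<noteq> (z \<in> B x)}"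
    using fin by (simp add: sum_of_bool_eq Int_def)
  have split: "card {z \<in> ?W. z \<in> B x} + card {z \<in> ?W. z \<notin> B x} = 4 * k - 2"
    unfolding card_W[symmetric] using fin
    by (subst card_Un_disjoint[symmetric]) (auto intro: arg_cong[where f = card])
  have "card {x, \<tau> x, y, \<tau> y} \<le> card V" using sub4 finite_V by (rule card_mono[rotated])
  \<comment> \<open>This ensures that the natural-number differences \<open>4 * k - 2\<close> and
    \<open>2 * k - 2\<close> are not truncated.\<close>
  then have k: "k \<ge> 1" using card4 card_V by simp
  show ?thesis
  proof (cases "y \<in> B x")
    case True
    then have "{z \<in> ?W. z \<in> B x} = B x - {y, \<tau> y}" "{y, \<tau> y} \<subseteq> B x" "card {y, \<tau> y} = 2"
      using B_subset[OF x] not_in_B[OF x] \<tau>x tau_B[OF x] tau_neq[of y] y by auto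
    then have "card {z \<in> ?W. z \<in> B x} = 2 * k - 2"
      using fin card_B[OF x] by (simp add: card_Diff_subset)
    then show ?thesis using True split sum k by (cases "s x") simp_all
  next
    case False
    then have "{z \<in> ?W. z \<in> B x} = B x"
      using B_subset[OF x] not_in_B[OF x] \<tau>x tau_in_B_iff[of x y] x y by auto
    then have "card {z \<in> ?W. z \<in> B x} = 2 * k"
      using card_B[OF x] by simp
    then show ?thesis using False split sum k by (cases "s x") simp_all
  qed
qed

text \<open>The edges correspond to the third vertices of negative sign, exactly one in each of the
  \<open>2 * k\<close> remaining pairs.\<close>

lemma card_edges_containing_tau_pair:
  assumes x: "x \<in> V"
  shows "card {e \<in> majority_edges. {x, \<tau> x} \<subseteq> e} = 2 * k"
proof -
  let ?W = "V - {x, \<tau> x}"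
  have "card {e \<in> majority_edges. {x, \<tau> x} \<subseteq> e} =
      (\<Sum>z\<in>?W. of_bool ({x, \<tau> x, z} \<in> majority_edges))"
    by (rule card_edges_containing_pair) (use x tau_closed[OF x] tau_neq[OF x] in auto)
  also have "\<dots> = (\<Sum>z\<in>?W. of_bool (\<not> s z))"
    using pair_with_tau_edge_iff[OF x] by (intro sum.cong) auto
  finally have "2 * card {e \<in> majority_edges. {x, \<tau> x} \<subseteq> e} =
      2 * (\<Sum>z\<in>?W. of_bool (\<not> s z))"
    by (rule arg_cong)
  also have "\<dots> = (\<Sum>z\<in>?W. of_bool (\<not> s z) + of_bool (\<not> s (\<tau> z)))"
    by (rule sum_tau_double) (use tau_closed_Diff[OF x] in blast)+
  also have "\<dots> = (\<Sum>z\<in>?W. 1)"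
    using sign_tau by (intro sum.cong) auto
  also have "\<dots> = 4 * k"
    using x tau_closed[OF x] tau_neq[OF x] finite_V card_V by (simp add: card_Diff_subset)
  finally show ?thesis by simp
qed

text \<open>The third vertices \<open>\<tau> x\<close> and \<open>\<tau> y\<close> are treated
  apart: they give edges exactly when \<open>s y\<close>, respectively \<open>s x\<close>, fails.
  These edges compensate for the missing positive votes of \<open>y\<close> and \<open>x\<close>
  over the other third vertices.\<close>

lemma card_edges_containing_general_pair:
  assumes x: "x \<in> V" and y: "y \<in> V" "y \<noteq> x" "y \<noteq> \<tau> x"
  shows "card {e \<in> majority_edges. {x, y} \<subseteq> e} = 2 * k"
proof -
  let ?W = "V - {x, \<tau> x, y, \<tau> y}"
  let ?f = "\<lambda>z. of_bool ({x, y, z} \<in> majority_edges) :: nat"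
  let ?p = "\<lambda>z. of_bool (s x \<longleftrightarrow> (y \<in> B x) \<noteq> (z \<in> B x)) :: nat"
  let ?q = "\<lambda>z. of_bool (s y \<longleftrightarrow> (x \<in> B y) \<noteq> (z \<in> B y)) :: nat"
  have ne: "x \<noteq> \<tau> y" "\<tau> x \<noteq> \<tau> y" "\<tau> x \<noteq> x" "\<tau> y \<noteq> y"
    using x y tau_tau tau_neq by metis+
  have V: "V - {x, y} = insert (\<tau> x) (insert (\<tau> y) ?W)"
    using x y ne tau_closed by auto
  have fx: "?f (\<tau> x) = of_bool (\<not> s y)"
    using pair_with_tau_edge_iff[of x y] x y by (simp add: insert_commute)
  have fy: "?f (\<tau> y) = of_bool (\<not> s x)"
    using pair_with_tau_edge_iff[of y x] x y ne by (simp add: insert_commute)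
  \<comment> \<open>If \<open>x\<close> and \<open>y\<close> agree, they settle both triples; if
    not, the third vertex decides, and its vote differs between \<open>z\<close> and
    \<open>\<tau> z\<close>, so exactly one triple is an edge.\<close>
  have pair: "?f z + ?f (\<tau> z) = ?p z + ?q z" if z: "z \<in> ?W" for z
  proof -
    have z': "z \<in> V" "\<tau> z \<in> V - {x, \<tau> x}" "\<tau> z \<in> V - {y, \<tau> y}"
      using z tau_closed_Diff x y by blast+
    define P where "P \<longleftrightarrow> (s x \<longleftrightarrow> (y \<in> B x) \<noteq> (z \<in> B x))"
    define Q where "Q \<longleftrightarrow> (s y \<longleftrightarrow> (x \<in> B y) \<noteq> (z \<in> B y))"
    define R where "R \<longleftrightarrow> (s z \<longleftrightarrow> (x \<in> B z) \<noteq> (y \<in> B z))"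
    have "{x, y, z} \<in> majority_edges \<longleftrightarrow> P \<and> Q \<or> P \<and> R \<or> Q \<and> R"
      unfolding P_def Q_def R_def by (rule triple_edge_iff) (use x y z in auto)
    moreover have "{x, y, \<tau> z} \<in> majority_edges \<longleftrightarrow> P \<and> Q \<or> P \<and> \<not> R \<or> Q \<and> \<not> R"
    proof -
      have "R \<noteq> (s (\<tau> z) \<longleftrightarrow> (x \<in> B (\<tau> z)) \<noteq> (y \<in> B (\<tau> z)))"
        unfolding R_def using sign_tau[OF z'(1)] B_tau[OF z'(1)] by blast
      moreover have "P \<longleftrightarrow> (s x \<longleftrightarrow> (y \<in> B x) \<noteq> (\<tau> z \<in> B x))"
        "Q \<longleftrightarrow> (s y \<longleftrightarrow> (x \<in> B y) \<noteq> (\<tau> z \<in> B y))"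
        unfolding P_def Q_def using tau_in_B_iff z'(1) x y(1) by simp_all
      ultimately show ?thesis
        using triple_edge_iff[of x y "\<tau> z"] x y z' by blast
    qed
    ultimately show ?thesis
      unfolding P_def[symmetric] Q_def[symmetric] by (cases P; cases Q; cases R) simp_all
  qed
  have "2 * (\<Sum>z\<in>?W. ?f z) = (\<Sum>z\<in>?W. ?f z + ?f (\<tau> z))"
    by (rule sum_tau_double) (use tau_closed_Diff[OF x] tau_closed_Diff[OF y(1)] in blast)+
  also have "\<dots> = (\<Sum>z\<in>?W. ?p z + ?q z)"
    using pair by (rule sum.cong[OF refl])
  also have "\<dots> = (\<Sum>z\<in>?W. ?p z) + (\<Sum>z\<in>?W. ?q z)"
    by (rule sum.distrib)
  finally have double: "2 * (\<Sum>z\<in>?W. ?f z) = (\<Sum>z\<in>?W. ?p z) + (\<Sum>z\<in>?W. ?q z)" .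
  have p: "(\<Sum>z\<in>?W. ?p z) + 2 * of_bool (\<not> s x) = 2 * k"
    using card_positive_votes[OF x y] .
  have "{y, \<tau> y, x, \<tau> x} = {x, \<tau> x, y, \<tau> y}" by auto
  then have q: "(\<Sum>z\<in>?W. ?q z) + 2 * of_bool (\<not> s y) = 2 * k"
    using card_positive_votes[of y x] x y ne by metis
  have "card {e \<in> majority_edges. {x, y} \<subseteq> e} = (\<Sum>z\<in>V - {x, y}. ?f z)"
    by (rule card_edges_containing_pair) (use x y in auto)
  also have "\<dots> = ?f (\<tau> x) + (?f (\<tau> y) + (\<Sum>z\<in>?W. ?f z))"
  proof -
    have "finite (insert (\<tau> y) ?W)" "finite ?W" "\<tau> x \<notin> insert (\<tau> y) ?W" "\<tau> y \<notin> ?W"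
      using finite_V ne by auto
    then show ?thesis unfolding V by (simp only: sum.insert not_False_eq_True)
  qed
  finally show ?thesis using double p q fx fy by linarith
qed

lemma subset_regular_majority: "subset_regular 2 (V, majority_edges)"
proof -
  \<comment> \<open>The value is half of the \<open>4 * k\<close> possible third vertices, as
    self-complementarity forces.\<close>
  have "card {e \<in> majority_edges. T \<subseteq> e} = 2 * k" if T: "T \<in> nsets V 2" for T
  proof -
    obtain x y where "T = {x, y}" "x \<noteq> y" "x \<in> V" "y \<in> V"
      using T by (auto simp: nsets_def card_2_iff)
    then show ?thesis
      using card_edges_containing_tau_pair card_edges_containing_general_pair by metis
  qed
  then show ?thesis by (auto simp: subset_regular_def)
qed

lemma k_hypergraph_majority: "k_hypergraph 3 (V, majority_edges)"
  using finite_V by (auto simp: k_hypergraph_def majority_edges_def)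

end

section \<open>A concrete voting system on an initial segment of the naturals\<close>

text \<open>The pairs are \<open>{2 * i, 2 * i + 1}\<close>, cut into a first block of
  \<open>k\<close> pairs, one middle pair and a last block of \<open>k\<close> pairs. Vertices of
  the first block use the last block as \<open>B x\<close>; all others use the first, so
  \<open>x \<notin> B x\<close>.\<close>

lemma signed_vote_nat:
  "signed_vote {..<4 * k + 2} (\<lambda>x. if even x then x + 1 else x - 1) odd
    (\<lambda>x. if x < 2 * k then {2 * k + 2..<4 * k + 2} else {..<2 * k}) k"
proof unfold_locales
  fix x z :: nat
  assume "z \<in> (if x < 2 * k then {2 * k + 2..<4 * k + 2} else {..<2 * k})"
  then show "(if even z then z + 1 else z - 1)
      \<in> (if x < 2 * k then {2 * k + 2..<4 * k + 2} else {..<2 * k})"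
    by (simp split: if_splits; presburger)
next
  fix x :: nat
  \<comment> \<open>The bound \<open>2 * k\<close> is even, so it does not separate the two members
    of a pair.\<close>
  have "(if even x then x + 1 else x - 1) < 2 * k \<longleftrightarrow> x < 2 * k"
    by (simp split: if_splits; presburger)
  then show "(if (if even x then x + 1 else x - 1) < 2 * k
      then {2 * k + 2..<4 * k + 2} else {..<2 * k}) =
    (if x < 2 * k then {2 * k + 2..<4 * k + 2} else {..<2 * k})"
    by (simp only:)
next
  fix x :: nat
  assume "x \<in> {..<4 * k + 2}"
  then show "(if even x then x + 1 else x - 1) \<in> {..<4 * k + 2}"
    by (simp split: if_splits; presburger)
qed (auto elim: oddE)

theorem theorem1:
  fixes n :: nat
  assumes "n \<ge> 6" and "[n = 2] (mod 4)"
  shows "\<exists>\<Gamma> :: nat hypergraph. k_hypergraph 3 \<Gamma> \<and> card (verts \<Gamma>) = n \<and>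
           subset_regular 2 \<Gamma> \<and> self_complementary 3 \<Gamma>"
proof -
  have "n = 4 * (n div 4) + 2"
    using assms(2) by (simp add: cong_def) presburger
  then obtain k where n: "n = 4 * k + 2" by blast
  interpret signed_vote "{..<4 * k + 2}" "\<lambda>x. if even x then x + 1 else x - 1" odd
    "\<lambda>x. if x < 2 * k then {2 * k + 2..<4 * k + 2} else {..<2 * k}" k
    by (rule signed_vote_nat)
  show ?thesis
    using k_hypergraph_majority subset_regular_majority self_complementary_majority n
    by (intro exI[where x = "({..<4 * k + 2}, majority_edges)"]) simp
qed

end
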